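(* Let $\alpha,z\in\mathbb{C}$ with $z\ne -1$, and let $p,n$ be non-negative integers with $p\le n$. Then $$\sum_{j=0}^n\binom{n}{j}j^pH_j(\alpha)z^j=\sum_{l=0}^p\sum_{j=0}^p(-1)^l\binom{n}{l}\binom{n-l}{j-l}\,j!\,{p\brace j}\,(1+z)^{n-l}\left(H_{n-l}\!\left(\frac{1+\alpha z}{1+z}\right)-H_{n-l}\!\left(\frac{1}{1+z}\right)\right).$$
   Context: For $\alpha\in\mathbb{C}$, the generalized harmonic numbers are $H_0(\alpha)=0$ and $H_k(\alpha)=\sum_{j=1}^k\frac{\alpha^j}{j}$ for $k\ge 1$. ${p\brace j}$ denotes the Stirling number of the second kind. Conventions: $\binom{n-l}{j-l}=0$ if $j<l$; $0^0=1$. *)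

theory Defs
  imports Complex_Main "HOL-Combinatorics.Stirling"
begin

definition gen_harm :: "nat \<Rightarrow> complex \<Rightarrow> complex" where
  "gen_harm k \<alpha> = (\<Sum>j=1..k. \<alpha> ^ j / of_nat j)"

(* The binomial coefficient "n - l over j - l", which vanishes for j < l.  The case distinction
   is needed because truncated subtraction would give n - l choose 0 = 1 there. *)
definition shifted_binom :: "nat \<Rightarrow> nat \<Rightarrow> nat \<Rightarrow> nat" where
  "shifted_binom n j l = (if j < l then 0 else (n - l) choose (j - l))"

end

theory Submission
  imports Defs
begin

text \<open>
  Put \<open>F n = (\<Sum>j\<le>n. (n choose j) * a j)\<close>. Pascal's rule gives
  \<open>F (n + 1) - F n = (\<Sum>j\<le>n. (n choose j) * a (j + 1))\<close>, so the \<open>m\<close>-th backward difference of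
  the binomial transform is the binomial transform of the \<open>m\<close>-fold shift. With
  \<open>a j = H_j(\<alpha>) z^j\<close> and \<open>j^p = (\<Sum>m. Stirling p m * m! * (j choose m))\<close> this reduces the claim to
  \<open>p = 0\<close>. There both sides solve \<open>X (n + 1) = (1 + z) X n + ((1 + \<alpha> z)^(n + 1) - 1) / (n + 1)\<close>
  with \<open>X 0 = 0\<close>.
\<close>

text \<open>Pascal's rule under a sum. The weight \<open>g\<close> is arbitrary because the lemma
  serves both the transform itself and the signed coefficients of its iterated differences.\<close>

lemma sum_binomial_Suc:
  fixes g :: "nat \<Rightarrow> 'a::comm_semiring_1"
  shows "(\<Sum>l\<le>Suc m. of_nat (Suc m choose l) * g l) =
    (\<Sum>l\<le>m. of_nat (m choose l) * (g l + g (Suc l)))"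
proof -
  have "(\<Sum>l\<le>Suc m. of_nat (Suc m choose l) * g l) =
      g 0 + (\<Sum>l\<le>m. of_nat (m choose Suc l) * g (Suc l)) + (\<Sum>l\<le>m. of_nat (m choose l) * g (Suc l))"
    by (subst sum.atMost_Suc_shift) (simp add: algebra_simps sum.distrib)
  also have "g 0 + (\<Sum>l\<le>m. of_nat (m choose Suc l) * g (Suc l)) =
      (\<Sum>l\<le>Suc m. of_nat (m choose l) * g l)"
    by (subst sum.atMost_Suc_shift) simp
  also have "\<dots> = (\<Sum>l\<le>m. of_nat (m choose l) * g l)"
    by (simp add: binomial_eq_0)
  finally show ?thesis
    by (simp add: algebra_simps sum.distrib)
qed

definition binomial_transform :: "(nat \<Rightarrow> 'a::comm_ring_1) \<Rightarrow> nat \<Rightarrow> 'a" where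
  "binomial_transform a n = (\<Sum>j\<le>n. of_nat (n choose j) * a j)"

lemma binomial_transform_Suc:
  "binomial_transform a (Suc n) = binomial_transform a n + binomial_transform (\<lambda>j. a (Suc j)) n"
  by (simp only: binomial_transform_def sum_binomial_Suc) (simp add: algebra_simps sum.distrib)

text \<open>Induction on \<open>m\<close> with \<open>a\<close> varying:
  \<open>sum_binomial_Suc\<close> pairs the neighbours \<open>l\<close> and \<open>Suc l\<close>
  into first differences of the transform, which are transforms of the shifted sequence. Since
  \<open>l \<le> m\<close>, the subtraction in \<open>k + m - l\<close> never truncates.\<close>

lemma backward_difference_binomial_transform:
  "(\<Sum>l\<le>m. of_nat (m choose l) * ((-1) ^ l * binomial_transform a (k + m - l))) =
    binomial_transform (\<lambda>j. a (j + m)) k"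
proof (induction m arbitrary: a)
  case (Suc m)
  have step: "(-1) ^ l * binomial_transform a (k + Suc m - l) +
      (-1) ^ Suc l * binomial_transform a (k + Suc m - Suc l) =
      (-1) ^ l * binomial_transform (\<lambda>j. a (Suc j)) (k + m - l)" if "l \<le> m" for l
  proof -
    have "k + Suc m - l = Suc (k + m - l)" using that by simp
    then show ?thesis by (simp add: binomial_transform_Suc algebra_simps)
  qed
  show ?case
    unfolding sum_binomial_Suc using Suc.IH[of "\<lambda>j. a (Suc j)"] step
    by simp
qed simp

text \<open>Choosing \<open>j\<close> out of \<open>n\<close> and then \<open>m\<close> out of those
  amounts to choosing the \<open>m\<close> first and the other \<open>j - m\<close> from the
  remaining \<open>n - m\<close>; then \<open>j\<close> is shifted by \<open>m\<close>.\<close>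

lemma sum_binomial_mult_choose:
  fixes a :: "nat \<Rightarrow> 'a::comm_ring_1"
  assumes "m \<le> n"
  shows "(\<Sum>j\<le>n. of_nat (n choose j) * of_nat (j choose m) * a j) =
    of_nat (n choose m) * binomial_transform (\<lambda>j. a (j + m)) (n - m)"
proof -
  have "(\<Sum>j\<le>n. of_nat (n choose j) * of_nat (j choose m) * a j) =
      (\<Sum>j\<in>{m..n}. of_nat (n choose j) * of_nat (j choose m) * a j)"
    by (rule sum.mono_neutral_right) (auto simp: binomial_eq_0)
  also have "\<dots> = (\<Sum>j\<in>{m..n}. of_nat (n choose m) * (of_nat ((n - m) choose (j - m)) * a j))"
    by (intro sum.cong refl)
      (simp flip: of_nat_mult mult.assoc add: choose_mult)
  also have "\<dots> = (\<Sum>j\<le>n - m. of_nat (n choose m) * (of_nat ((n - m) choose j) * a (j + m)))"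
    by (rule sum.reindex_bij_witness[of _ "\<lambda>j. j + m" "\<lambda>j. j - m"]) (use assms in auto)
  finally show ?thesis
    by (simp add: binomial_transform_def sum_distrib_left)
qed

text \<open>\<open>fact k * (x choose k)\<close> is the falling factorial of \<open>x\<close> of
  length \<open>k\<close>, so this is the splitting \<open>x = k + (x - k)\<close>. For
  \<open>k > x\<close> all terms vanish, whence the case distinction.\<close>

lemma mult_fact_mult_choose:
  "x * (fact k * (x choose k)) = k * (fact k * (x choose k)) + fact (Suc k) * (x choose Suc k)"
proof (cases "k \<le> x")
  case True
  have "Suc k * (x choose Suc k) = (x - k) * (x choose k)"
    by (metis binomial_absorb_comp binomial_absorption)
  then have "fact (Suc k) * (x choose Suc k) = fact k * ((x - k) * (x choose k))"
    by (simp only: fact_Suc of_nat_id mult.assoc mult.left_commute[of "Suc k"])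
  moreover have "x * (fact k * (x choose k)) = (k + (x - k)) * (fact k * (x choose k))"
    using True by simp
  ultimately show ?thesis
    by (simp only: distrib_right distrib_left mult.left_commute)
qed (simp add: binomial_eq_0)

lemma power_eq_sum_Stirling:
  "x ^ p = (\<Sum>k\<le>p. Stirling p k * (fact k * (x choose k)))"
proof (induction p)
  case (Suc p)
  let ?c = "\<lambda>k. fact k * (x choose k)"
  have "x ^ Suc p = (\<Sum>k\<le>p. Stirling p k * (x * ?c k))"
    by (simp add: Suc.IH sum_distrib_left mult.left_commute)
  also have "\<dots> = (\<Sum>k\<le>p. k * Stirling p k * ?c k) + (\<Sum>k\<le>p. Stirling p k * ?c (Suc k))"
    unfolding mult_fact_mult_choose[of x]
    by (simp only: distrib_left sum.distrib mult_ac)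
  \<comment> \<open>The added term is zero as \<open>Stirling p (Suc p) = 0\<close>, and the factor
    \<open>k\<close> kills the term at 0, so the index can be shifted to match the recurrence of the
    Stirling numbers.\<close>
  also have "(\<Sum>k\<le>p. k * Stirling p k * ?c k) = (\<Sum>k\<le>Suc p. k * Stirling p k * ?c k)"
    by simp
  also have "\<dots> = (\<Sum>k\<le>p. Suc k * Stirling p (Suc k) * ?c (Suc k))"
    by (subst sum.atMost_Suc_shift) simp
  also have "\<dots> + (\<Sum>k\<le>p. Stirling p k * ?c (Suc k)) =
      (\<Sum>k\<le>p. Stirling (Suc p) (Suc k) * ?c (Suc k))"
    by (simp only: Stirling.simps distrib_right sum.distrib)
  also have "\<dots> = (\<Sum>k\<le>Suc p. Stirling (Suc p) k * ?c k)"
    by (subst sum.atMost_Suc_shift) simp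
  finally show ?case .
qed simp

text \<open>This is the integral of \<open>(1 + t) ^ n\<close> from 0 to \<open>x\<close>, obtained
  algebraically: absorption removes the denominators and leaves the binomial theorem without its
  constant term.\<close>

lemma sum_binomial_power_div:
  fixes x :: "'a::field_char_0"
  shows "(\<Sum>j\<le>n. of_nat (n choose j) * (x ^ Suc j / of_nat (Suc j))) =
    ((1 + x) ^ Suc n - 1) / of_nat (Suc n)"
proof -
  have "of_nat (Suc n) * (of_nat (n choose j) * (x ^ Suc j / of_nat (Suc j))) =
      of_nat (Suc n choose Suc j) * x ^ Suc j" for j
  proof -
    have "(of_nat (Suc n) * of_nat (n choose j) :: 'a) = of_nat (Suc n choose Suc j) * of_nat (Suc j)"
      by (simp only: Suc_times_binomial_eq flip: of_nat_mult)
    then show ?thesis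
      by (simp add: field_simps del: of_nat_Suc binomial_Suc_Suc power_Suc)
  qed
  then have "of_nat (Suc n) * (\<Sum>j\<le>n. of_nat (n choose j) * (x ^ Suc j / of_nat (Suc j))) =
      (\<Sum>j\<le>n. of_nat (Suc n choose Suc j) * x ^ Suc j)"
    by (simp only: sum_distrib_left)
  also have "\<dots> = (x + 1) ^ Suc n - 1"
    by (simp only: binomial_ring sum.atMost_Suc_shift) simp
  finally show ?thesis
    by (simp add: field_simps del: of_nat_Suc power_Suc)
qed

lemma gen_harm_Suc: "gen_harm (Suc k) \<alpha> = gen_harm k \<alpha> + \<alpha> ^ Suc k / of_nat (Suc k)"
  by (simp add: gen_harm_def)

lemma binomial_transform_gen_harm:
  assumes "z \<noteq> -1"
  shows "binomial_transform (\<lambda>j. gen_harm j \<alpha> * z ^ j) n =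
    (1 + z) ^ n * (gen_harm n ((1 + \<alpha> * z) / (1 + z)) - gen_harm n (1 / (1 + z)))"
proof (induction n)
  case 0
  show ?case by (simp add: binomial_transform_def gen_harm_def)
next
  case (Suc n)
  have nz: "1 + z \<noteq> 0"
    using assms by (metis add.commute add_eq_0_iff)
  let ?F = "binomial_transform (\<lambda>j. gen_harm j \<alpha> * z ^ j)"
  let ?D = "\<lambda>n. gen_harm n ((1 + \<alpha> * z) / (1 + z)) - gen_harm n (1 / (1 + z))"
  have "gen_harm (Suc j) \<alpha> * z ^ Suc j =
      z * (gen_harm j \<alpha> * z ^ j) + (\<alpha> * z) ^ Suc j / of_nat (Suc j)" for j
    by (simp add: gen_harm_Suc distrib_right power_mult_distrib del: of_nat_Suc)
  then have "binomial_transform (\<lambda>j. gen_harm (Suc j) \<alpha> * z ^ Suc j) n =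
      z * ?F n + (\<Sum>j\<le>n. of_nat (n choose j) * ((\<alpha> * z) ^ Suc j / of_nat (Suc j)))"
    by (simp only: binomial_transform_def distrib_left sum.distrib sum_distrib_left mult.left_commute)
  then have "?F (Suc n) = (1 + z) * ?F n + ((1 + \<alpha> * z) ^ Suc n - 1) / of_nat (Suc n)"
    by (simp only: binomial_transform_Suc sum_binomial_power_div) (simp add: algebra_simps)
  also have "\<dots> = (1 + z) ^ Suc n * ?D (Suc n)"
  proof -
    \<comment> \<open>The prefactor clears the power of \<open>1 + z\<close> in the last term of
      each harmonic number; \<open>x = 1 + \<alpha> * z\<close> and \<open>x = 1\<close> yield the
      inhomogeneous part of the recurrence.\<close>
    have "(1 + z) ^ Suc n * ((x / (1 + z)) ^ Suc n / of_nat (Suc n)) = x ^ Suc n / of_nat (Suc n)" for x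
      using nz by (simp add: power_divide del: of_nat_Suc power_Suc)
    from this[of "1 + \<alpha> * z"] this[of 1]
    have "(1 + z) ^ Suc n * ?D (Suc n) = (1 + z) ^ Suc n * ?D n +
        ((1 + \<alpha> * z) ^ Suc n / of_nat (Suc n) - 1 ^ Suc n / of_nat (Suc n))"
      by (simp only: gen_harm_Suc right_diff_distrib distrib_left) simp
    then show ?thesis
      by (simp add: Suc.IH diff_divide_distrib del: of_nat_Suc)
  qed
  finally show ?case .
qed

text \<open>For \<open>j < l\<close> both sides are zero, on the left by the convention in
  \<open>shifted_binom\<close>.\<close>

lemma choose_mult_shifted_binom:
  assumes "j \<le> n"
  shows "(n choose l) * shifted_binom n j l = (n choose j) * (j choose l)"
  using assms by (auto simp: shifted_binom_def choose_mult)

theorem mainTheorem6: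
  fixes \<alpha> z :: complex and p n :: nat
  assumes "z \<noteq> -1" and "p \<le> n"
  shows "(\<Sum>j=0..n. of_nat (n choose j) * of_nat j ^ p * gen_harm j \<alpha> * z ^ j) =
    (\<Sum>l=0..p. \<Sum>j=0..p. (-1) ^ l * of_nat (n choose l) * of_nat (shifted_binom n j l)
       * fact j * of_nat (Stirling p j) * (1 + z) ^ (n - l)
       * (gen_harm (n - l) ((1 + \<alpha> * z) / (1 + z)) - gen_harm (n - l) (1 / (1 + z))))"
proof -
  define a where "a j = gen_harm j \<alpha> * z ^ j" for j
  let ?F = "binomial_transform a"
  have "(\<Sum>j=0..n. of_nat (n choose j) * of_nat j ^ p * gen_harm j \<alpha> * z ^ j) =
      (\<Sum>j\<le>n. \<Sum>m\<le>p. of_nat (Stirling p m) * fact m * (of_nat (n choose j) * of_nat (j choose m) * a j))"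
  proof (intro sum.cong)
    fix j
    have "(of_nat j ^ p :: complex) = of_nat (j ^ p)" by simp
    then show "of_nat (n choose j) * of_nat j ^ p * gen_harm j \<alpha> * z ^ j =
        (\<Sum>m\<le>p. of_nat (Stirling p m) * fact m * (of_nat (n choose j) * of_nat (j choose m) * a j))"
      by (simp only: power_eq_sum_Stirling)
        (simp add: a_def sum_distrib_left sum_distrib_right mult_ac)
  qed auto
  also have "\<dots> = (\<Sum>m\<le>p. of_nat (Stirling p m) * fact m *
      (\<Sum>j\<le>n. of_nat (n choose j) * of_nat (j choose m) * a j))"
    by (subst sum.swap) (simp add: sum_distrib_left)
  also have "\<dots> = (\<Sum>m\<le>p. \<Sum>l\<le>p. (-1) ^ l * of_nat (n choose l) * of_nat (shifted_binom n m l)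
      * fact m * of_nat (Stirling p m) * ?F (n - l))"
  proof (intro sum.cong refl)
    fix m assume "m \<in> {..p}"
    then have m: "m \<le> p" "m \<le> n" using assms by auto
    \<comment> \<open>The difference formula is taken at \<open>k = n - m\<close>; as
      \<open>m \<le> p \<le> n\<close>, its index \<open>k + m - l\<close> is
      \<open>n - l\<close>.\<close>
    have "(\<Sum>j\<le>n. of_nat (n choose j) * of_nat (j choose m) * a j) =
        of_nat (n choose m) * (\<Sum>l\<le>m. of_nat (m choose l) * ((-1) ^ l * ?F (n - l)))"
      using m backward_difference_binomial_transform[of m a "n - m"]
      by (simp add: sum_binomial_mult_choose)
    \<comment> \<open>Padding with zero terms makes the range of \<open>l\<close> independent of
      \<open>m\<close>, so that the two sums can be swapped at the end.\<close>
    also have "(\<Sum>l\<le>m. of_nat (m choose l) * ((-1) ^ l * ?F (n - l))) =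
        (\<Sum>l\<le>p. of_nat (m choose l) * ((-1) ^ l * ?F (n - l)))"
      using m by (intro sum.mono_neutral_left) (auto simp: binomial_eq_0)
    finally have "of_nat (Stirling p m) * fact m * (\<Sum>j\<le>n. of_nat (n choose j) * of_nat (j choose m) * a j) =
        (\<Sum>l\<le>p. (-1) ^ l * of_nat ((n choose m) * (m choose l)) * fact m * of_nat (Stirling p m) * ?F (n - l))"
      by (simp add: sum_distrib_left mult_ac)
    then show "of_nat (Stirling p m) * fact m * (\<Sum>j\<le>n. of_nat (n choose j) * of_nat (j choose m) * a j) =
        (\<Sum>l\<le>p. (-1) ^ l * of_nat (n choose l) * of_nat (shifted_binom n m l)
          * fact m * of_nat (Stirling p m) * ?F (n - l))"
      by (simp only: of_nat_mult mult.assoc flip: choose_mult_shifted_binom[OF m(2)])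
  qed
  also have "\<dots> = (\<Sum>l=0..p. \<Sum>j=0..p. (-1) ^ l * of_nat (n choose l) * of_nat (shifted_binom n j l)
       * fact j * of_nat (Stirling p j) * (1 + z) ^ (n - l)
       * (gen_harm (n - l) ((1 + \<alpha> * z) / (1 + z)) - gen_harm (n - l) (1 / (1 + z))))"
    unfolding a_def[abs_def] binomial_transform_gen_harm[OF assms(1)] atLeast0AtMost
    by (subst sum.swap) (simp only: mult.assoc)
  finally show ?thesis .
qed

end
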